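(* Let $k\ge2$ and let $x_1,\dots,x_k\in[0,1]$ be arbitrary (not necessarily distinct). For $N\ge k$ define recursively $x_{N+1}:=\min\operatorname*{arg\,min}_{x\in[0,1)}f_N(x)$ (the smallest global minimizer of $f_N$ on $[0,1)$), where $$f_N(x):=-2\sum_{n=1}^N\max\{x_n,x\}+(N+1)x^2-x.$$ Then $x_N\in\Gamma_N:=\left\{\frac{2l-1}{2N}:l=1,2,\dots,N\right\}$ for all $N\ge k+1$.
   Context: $\operatorname*{arg\,min}_{x\in M}f(x)$ denotes the set $\{x\in M: f(x)\le f(y)\text{ for all }y\in M\}$. *)

theory Defs
  imports "HOL-Analysis.Analysis"
begin

definition argmin_set :: "real set \<Rightarrow> (real \<Rightarrow> real) \<Rightarrow> real set" where
  "argmin_set M f = {x \<in> M. \<forall>y\<in>M. f x \<le> f y}"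

(* Sequences are indexed from 1; the value x 0 is never used. *)
definition objective :: "(nat \<Rightarrow> real) \<Rightarrow> nat \<Rightarrow> real \<Rightarrow> real" where
  "objective x N t = - 2 * (\<Sum>n=1..N. max (x n) t) + (real N + 1) * t\<^sup>2 - t"

definition Gamma_set :: "nat \<Rightarrow> real set" where
  "Gamma_set N = {(2 * real l - 1) / (2 * real N) | l. l \<in> {1..N}}"

end

theory Submission
  imports Defs
begin

text \<open>
  Replacing the convex function \<open>max (x n)\<close> by its tangent at \<open>t\<close> bounds \<open>objective x N\<close> from above
  by a parabola that touches it at \<open>t\<close>. The vertex of this parabola is \<open>(2 * c + 1) / (2 * (N + 1))\<close>
  with \<open>c\<close> the number of \<open>n \<le> N\<close> with \<open>x n \<le> t\<close>, hence a point of \<open>Gamma_set (N + 1)\<close>. So the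
  objective at the vertex is smaller than at \<open>t\<close> unless \<open>t\<close> is the vertex itself, and minimizing over
  \<open>[0,1)\<close> amounts to minimizing over the finite set \<open>Gamma_set (N + 1)\<close>.
\<close>

lemma finite_Gamma_set: "finite (Gamma_set N)"
  unfolding Gamma_set_def by (rule finite_image_set) simp

lemma Gamma_set_nonempty: "N \<ge> 1 \<Longrightarrow> Gamma_set N \<noteq> {}"
  unfolding Gamma_set_def by auto

lemma Gamma_set_subset: "Gamma_set N \<subseteq> {0..<1}"
proof
  fix g assume "g \<in> Gamma_set N"
  then obtain l where "g = (2 * real l - 1) / (2 * real N)" "1 \<le> l" "l \<le> N"
    unfolding Gamma_set_def by auto
  then show "g \<in> {0..<1}"
    by (simp add: pos_divide_less_eq)
qed

text \<open>The quadratic term is the exact drop of the parabola from \<open>t\<close> to its vertex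
  \<open>g\<close>, since the leading coefficient is \<open>N + 1\<close>. Keeping it forces
  \<open>t = g\<close> at a minimizer.\<close>

lemma objective_Gamma_le:
  "\<exists>g\<in>Gamma_set (N + 1). objective x N g + (real N + 1) * (t - g)\<^sup>2 \<le> objective x N t"
proof -
  define c where "c = card {n \<in> {1..N}. x n \<le> t}"
  define g where "g = (2 * real c + 1) / (2 * (real N + 1))"
  have "c \<le> card {1..N}"
    unfolding c_def by (intro card_mono) auto
  then have "g = (2 * real (c + 1) - 1) / (2 * real (N + 1))" "c + 1 \<in> {1..N + 1}"
    by (simp_all add: g_def add.commute)
  then have "g \<in> Gamma_set (N + 1)"
    unfolding Gamma_set_def by blast
  \<comment> \<open>Termwise subgradient inequality; at a kink \<open>x n = t\<close> the right-hand
    slope 1 is chosen.\<close>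
  have "(\<Sum>n=1..N. max (x n) t) + (\<Sum>n=1..N. if x n \<le> t then g - t else 0)
      \<le> (\<Sum>n=1..N. max (x n) g)"
    unfolding sum.distrib[symmetric] by (intro sum_mono) auto
  also have "(\<Sum>n=1..N. if x n \<le> t then g - t else 0) = real c * (g - t)"
    by (simp add: c_def sum.If_cases Int_def)
  finally have tangent: "(\<Sum>n=1..N. max (x n) t) + real c * (g - t) \<le> (\<Sum>n=1..N. max (x n) g)" .
  \<comment> \<open>Vanishing of the parabola's derivative at \<open>g\<close>, solved for
    \<open>c\<close>.\<close>
  have c_eq: "real c = (real N + 1) * g - 1 / 2"
    by (simp add: g_def field_simps)
  have "objective x N g + (real N + 1) * (t - g)\<^sup>2 \<le> objective x N t"
    using tangent unfolding c_eq objective_def by (simp add: field_simps power2_eq_square)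
  with \<open>g \<in> Gamma_set (N + 1)\<close> show ?thesis ..
qed

lemma argmin_objective_subset_Gamma:
  "argmin_set {0..<1} (objective x N) \<subseteq> Gamma_set (N + 1)"
proof
  fix t assume t: "t \<in> argmin_set {0..<1} (objective x N)"
  obtain g where g: "g \<in> Gamma_set (N + 1)"
    and le: "objective x N g + (real N + 1) * (t - g)\<^sup>2 \<le> objective x N t"
    using objective_Gamma_le by blast
  have "objective x N t \<le> objective x N g"
    using t g Gamma_set_subset by (auto simp: argmin_set_def)
  with le have "(real N + 1) * (t - g)\<^sup>2 \<le> 0"
    by linarith
  then have "t = g"
    by (simp add: mult_le_0_iff)
  with g show "t \<in> Gamma_set (N + 1)"
    by simp
qed

text \<open>As [0,1) is not compact, continuity alone would not suffice; a minimizer over the finite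
  \<open>Gamma_set (N + 1)\<close> is global because every real \<open>t\<close> is dominated by
  some point of that set.\<close>

lemma argmin_objective_nonempty: "argmin_set {0..<1} (objective x N) \<noteq> {}"
proof -
  have "finite (Gamma_set (N + 1))" "Gamma_set (N + 1) \<noteq> {}"
    by (simp_all add: finite_Gamma_set Gamma_set_nonempty)
  then obtain m where m: "m \<in> Gamma_set (N + 1)"
    and min: "\<And>g. g \<in> Gamma_set (N + 1) \<Longrightarrow> objective x N m \<le> objective x N g"
    by (metis arg_min_if_finite(1) arg_min_least)
  have "objective x N m \<le> objective x N t" for t
  proof -
    obtain g where g: "g \<in> Gamma_set (N + 1)"
      and "objective x N g + (real N + 1) * (t - g)\<^sup>2 \<le> objective x N t"
      using objective_Gamma_le by blast
    moreover have "0 \<le> (real N + 1) * (t - g)\<^sup>2"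
      by simp
    ultimately show ?thesis
      using min[OF g] by linarith
  qed
  with m show ?thesis
    using Gamma_set_subset unfolding argmin_set_def by blast
qed

lemma Least_in_finite:
  fixes S :: "'a::linorder set"
  assumes "finite S" "S \<noteq> {}"
  shows "(LEAST t. t \<in> S) \<in> S"
  using assms Least_Min[of "\<lambda>t. t \<in> S"] Min_in[of S] by (simp add: ex_in_conv)

theorem mainTheorem3:
  fixes k :: nat and x :: "nat \<Rightarrow> real"
  assumes "k \<ge> 2"
    and "\<And>n. n \<in> {1..k} \<Longrightarrow> x n \<in> {0..1}"
    and "\<And>N. N \<ge> k \<Longrightarrow>
           x (N + 1) = (LEAST t. t \<in> argmin_set {0..<1} (objective x N))"
  shows "\<forall>N\<ge>k + 1. x N \<in> Gamma_set N"
proof (intro allI impI)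
  fix N assume "N \<ge> k + 1"
  then obtain M where N: "N = M + 1" and "M \<ge> k"
    by (metis add_le_cancel_right le_add2 le_add_diff_inverse2 order_trans)
  let ?A = "argmin_set {0..<1} (objective x M)"
  \<comment> \<open>Over the reals, \<open>LEAST\<close> need not lie in the set; finiteness
    together with nonemptiness ensures it here.\<close>
  have "finite ?A"
    using argmin_objective_subset_Gamma finite_Gamma_set by (rule finite_subset)
  then have "x N \<in> ?A"
    using assms(3)[OF \<open>M \<ge> k\<close>] Least_in_finite argmin_objective_nonempty N by metis
  then show "x N \<in> Gamma_set N"
    using argmin_objective_subset_Gamma N by blast
qed

end
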